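(* Let $\mathcal{H}_n$ be an $n$-dimensional Hilbert space (identified with $\mathbb{C}^n$ via an orthonormal basis), let $K$ be a linear operator on $\mathcal{H}_n$, and let $F$ be the $n\times m$ matrix whose columns are the vectors of a $K$-frame for $\mathcal{H}_n$. In all matrix products below the sizes are assumed compatible. Then: (i) $AFU$ is a $T_AK$-frame for any square matrix $A$ and any unitary matrix $U$. In particular $FU$ is a $K$-frame; and $GU\in KD_{AFU}$ for every $G\in KD_F$. (ii) If $A$ is invertible and $U$ is a unitary matrix, then $G\in KD_F$ if and only if $GU\in KD_{AFU}$. (iii) If $F$ is an $\alpha$-tight $K$-frame, then $AFU$ is a $T_AK$-frame for any matrix $A$ and any unitary matrix $U$. Moreover, $FU$ is an $\alpha$-tight $K$-frame. (iv) If $F$ is equal norm (EN), then $UFD$ is also EN for any unitary matrix $U$ and any unitary diagonal matrix $D$. (v) If $F$ is a maximal robust (MR) $K$-frame, then $AFD$, as a $T_AK$-frame, is MR for any invertible matrix $A$ and any unitary diagonal matrix $D$. (vi) If $F$ satisfies MRC for $r$-erasures, then $AFD$, as a $T_AK$-frame, satisfies MRC for $r$-erasures for any unitary diagonal matrix $D$ and any square matrix $A$.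
   Context: A sequence is identified with the matrix having its vectors as columns (its synthesis matrix). $M_K$ is the matrix of $K$ and $T_A$ is the operator with matrix $A$. For a linear operator $L$, a sequence $F$ of vectors (in the codomain of $L$) is an $L$-frame if the range of $L$ is contained in the span of the columns of $F$; a matrix $G$ (whose columns lie in the domain of $L$, with the same number of columns as $F$) is an $L$-dual of $F$ if $FG^{*}=M_L$. $KD_F$ denotes the set of all $K$-duals of the $K$-frame $F$; $KD_{AFU}$ denotes the set of all $T_AK$-duals of the $T_AK$-frame $AFU$, i.e. the matrices $H$ with $AFUH^{*}=AM_K$. A $K$-frame $F$ is $\alpha$-tight if $FF^{*}=\alpha M_KM_K^{*}$. $F$ is equal norm (EN) if all its columns have equal norm. A $K$-frame is exact if it ceases to be a $K$-frame whenever any one of its vectors is removed. A $K$-frame $F$ is maximal robust (MR) if every $\operatorname{rank}K$ columns of $F$ form an exact $K$-frame. An index set $\sigma\subset I_m=\{1,\dots,m\}$ satisfies the minimal redundancy condition (MRC) for a $K$-frame $F=\{f_i\}_{i\in I_m}$ if $\{f_i\}_{i\in I_m\setminus\sigma}$ is a $K$-frame, and $F$ satisfies MRC for $r$-erasures if every $\sigma\subset I_m$ with $|\sigma|=r$ satisfies MRC for $F$. "As a $T_AK$-frame" means that these notions are taken with $K$ replaced by $T_AK$. *)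

theory Defs
  imports "HOL-Analysis.Analysis"
begin

text \<open>
  A sequence of vectors in \<open>\<complex>\<^sup>n\<close> indexed by the finite type \<open>'m\<close> is its synthesis matrix
  \<open>F :: complex^'m^'n\<close>: the \<open>i\<close>-th vector is \<open>column i F\<close>, the index set \<open>I\<^sub>m\<close> is \<open>UNIV\<close>. The matrix
  of a linear operator \<open>L\<close> is \<open>matrix L\<close>, and \<open>T\<^sub>A\<close> is \<open>(*v) A\<close>. Linearity and span are taken over
  \<open>\<complex>\<close>, i.e. with respect to the scalar multiplication \<open>(*s)\<close>; the unqualified \<open>linear\<close> and \<open>span\<close>
  would be over the reals.
\<close>

definition adj :: "complex^'b^'a \<Rightarrow> complex^'a^'b" where
  "adj M = (\<chi> i j. cnj (M $ j $ i))"

definition unitary_matrix :: "complex^'a^'a \<Rightarrow> bool" where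
  "unitary_matrix U \<longleftrightarrow> U ** adj U = mat 1 \<and> adj U ** U = mat 1"

definition diagonal_matrix :: "complex^'a^'a \<Rightarrow> bool" where
  "diagonal_matrix D \<longleftrightarrow> (\<forall>i j. i \<noteq> j \<longrightarrow> D $ i $ j = 0)"

text \<open>
  Subfamilies are given by the set \<open>S\<close> of indices that are kept, so that repeated vectors are
  counted with multiplicity.
\<close>

definition subframe :: "(complex^'a \<Rightarrow> complex^'b) \<Rightarrow> complex^'m^'b \<Rightarrow> 'm set \<Rightarrow> bool" where
  "subframe L F S \<longleftrightarrow> range L \<subseteq> vec.span ((\<lambda>i. column i F) ` S)"

definition is_frame :: "(complex^'a \<Rightarrow> complex^'b) \<Rightarrow> complex^'m^'b \<Rightarrow> bool" where
  "is_frame L F \<longleftrightarrow> subframe L F UNIV"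

definition duals :: "(complex^'a \<Rightarrow> complex^'b) \<Rightarrow> complex^'m^'b \<Rightarrow> (complex^'m^'a) set" where
  "duals L F = {G. F ** adj G = matrix L}"

definition tight_frame :: "real \<Rightarrow> (complex^'a \<Rightarrow> complex^'b) \<Rightarrow> complex^'m^'b \<Rightarrow> bool" where
  "tight_frame \<alpha> L F \<longleftrightarrow>
     is_frame L F \<and> F ** adj F = \<alpha> *\<^sub>R (matrix L ** adj (matrix L))"

definition equal_norm :: "complex^'m^'b \<Rightarrow> bool" where
  "equal_norm F \<longleftrightarrow> (\<forall>i j. norm (column i F) = norm (column j F))"

definition exact_subframe :: "(complex^'a \<Rightarrow> complex^'b) \<Rightarrow> complex^'m^'b \<Rightarrow> 'm set \<Rightarrow> bool" where
  "exact_subframe L F S \<longleftrightarrow> subframe L F S \<and> (\<forall>i\<in>S. \<not> subframe L F (S - {i}))"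

definition maximal_robust :: "(complex^'a \<Rightarrow> complex^'b) \<Rightarrow> complex^'m^'b \<Rightarrow> bool" where
  "maximal_robust L F \<longleftrightarrow>
     is_frame L F \<and> (\<forall>S. card S = vec.dim (range L) \<longrightarrow> exact_subframe L F S)"

definition MRC :: "(complex^'a \<Rightarrow> complex^'b) \<Rightarrow> complex^'m^'b \<Rightarrow> 'm set \<Rightarrow> bool" where
  "MRC L F \<sigma> \<longleftrightarrow> is_frame L F \<and> subframe L F (UNIV - \<sigma>)"

definition MRC_erasures :: "nat \<Rightarrow> (complex^'a \<Rightarrow> complex^'b) \<Rightarrow> complex^'m^'b \<Rightarrow> bool" where
  "MRC_erasures r L F \<longleftrightarrow> is_frame L F \<and> (\<forall>\<sigma>. card \<sigma> = r \<longrightarrow> MRC L F \<sigma>)"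

end

theory Submission
  imports Defs
begin

text \<open>
  A unitary factor on the right disappears from every product \<open>(X U)(Y U)\<^sup>*\<close>, which settles duals
  and tightness, and does not change the range of \<open>F\<close>. A diagonal unitary factor rescales each
  column by a unit scalar, so it preserves the span of every subfamily and not only of the whole
  family; this gives the statements about erasures and robustness. When \<open>A\<close> is invertible,
  non-spanning subfamilies also stay non-spanning, by applying the same argument to
  \<open>A\<^sup>-\<^sup>1\<close> and \<open>D\<^sup>*\<close>.
\<close>

lemma adj_adj [simp]: "adj (adj M) = M"
  by (simp add: adj_def vec_eq_iff)

lemma adj_matrix_mult: "adj (A ** B) = adj B ** adj A"
  by (simp add: adj_def vec_eq_iff matrix_matrix_mult_def mult.commute)

lemma unitary_matrix_adj: "unitary_matrix U \<Longrightarrow> unitary_matrix (adj U)"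
  by (simp add: unitary_matrix_def)

lemma diagonal_matrix_adj: "diagonal_matrix D \<Longrightarrow> diagonal_matrix (adj D)"
  by (simp add: diagonal_matrix_def adj_def)

lemma unitary_cancel:
  assumes "unitary_matrix U"
  shows "A ** U ** adj (B ** U) = A ** adj B"
proof -
  have "A ** U ** adj (B ** U) = A ** (U ** adj U) ** adj B"
    by (simp add: adj_matrix_mult matrix_mul_assoc)
  then show ?thesis using assms by (simp add: unitary_matrix_def)
qed

lemma column_matrix_mult: "column i (A ** B) = A *v column i B"
  by (simp add: column_def vec_eq_iff matrix_matrix_mult_def matrix_vector_mult_def)

lemma matrix_mult_diagonal:
  assumes "diagonal_matrix D"
  shows "(M ** D) $ k $ i = M $ k $ i * D $ i $ i"
proof -
  have "(\<Sum>j\<in>UNIV. M $ k $ j * D $ j $ i)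
      = (\<Sum>j\<in>UNIV. if j = i then M $ k $ i * D $ i $ i else 0)"
    using assms by (intro sum.cong) (auto simp: diagonal_matrix_def)
  then show ?thesis by (simp add: matrix_matrix_mult_def)
qed

lemma column_mult_diagonal:
  assumes "diagonal_matrix D"
  shows "column i (F ** D) = D $ i $ i *s column i F"
  using assms by (simp add: column_def vec_eq_iff matrix_mult_diagonal)

text \<open>Comparing diagonal entries in \<open>adj D ** D = mat 1\<close> leaves one product. It
  shows that the scalar on each column has modulus one and that its conjugate undoes it.\<close>

lemma unitary_diagonal_entry:
  assumes "unitary_matrix D" "diagonal_matrix D"
  shows "cnj (D $ i $ i) * D $ i $ i = 1"
proof -
  have "(adj D ** D) $ i $ i = 1"
    using assms(1) by (simp add: unitary_matrix_def mat_def)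
  then show ?thesis
    using assms(2) by (simp add: matrix_mult_diagonal) (simp add: adj_def)
qed

text \<open>Column norms are read off the Gram matrix, so their invariance under a left unitary
  factor becomes a matrix identity.\<close>

lemma gram_diagonal: "(adj M ** M) $ i $ i = of_real ((norm (column i M))\<^sup>2)"
proof -
  have "(norm (column i M))\<^sup>2 = (\<Sum>k\<in>UNIV. (norm (M $ k $ i))\<^sup>2)"
    by (simp add: norm_vec_def L2_set_def sum_nonneg column_def)
  moreover have "(adj M ** M) $ i $ i = (\<Sum>k\<in>UNIV. of_real ((norm (M $ k $ i))\<^sup>2))"
    unfolding matrix_matrix_mult_def adj_def
    \<comment> \<open>\<open>of_real\<close> must stay outside the square for
      \<open>complex_norm_square\<close> to match.\<close>
    by (simp add: complex_norm_square mult.commute del: of_real_power)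
  ultimately show ?thesis by simp
qed

lemma norm_column_unitary_diagonal:
  assumes U: "unitary_matrix U" and D: "unitary_matrix D" "diagonal_matrix D"
  shows "norm (column i (U ** F ** D)) = norm (column i F)"
proof -
  have "adj (U ** F) ** (U ** F) = adj F ** (adj U ** U) ** F"
    by (simp add: adj_matrix_mult matrix_mul_assoc)
  then have "norm (column i (U ** F)) = norm (column i F)"
    using U gram_diagonal[of "U ** F" i] gram_diagonal[of F i]
    by (simp add: unitary_matrix_def flip: of_real_power)
  moreover have "norm (D $ i $ i) = 1"
    using unitary_diagonal_entry[OF D, of i]
    by (metis complex_mod_cnj norm_mult norm_one norm_ge_zero abs_of_nonneg real_sqrt_abs2 real_sqrt_one)
  moreover have "norm (c *s x) = norm c * norm x" for c and x :: "complex^'a"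
    by (simp add: norm_vec_def norm_mult L2_set_right_distrib)
  ultimately show ?thesis
    using D by (simp add: column_mult_diagonal)
qed

text \<open>This turns the frame condition for the whole family into solvability of
  \<open>L x = F *v c\<close>, a form suited to a \<open>U\<close> that mixes the columns.\<close>

lemma span_columns_eq_range:
  fixes F :: "complex^'m^'n"
  shows "vec.span (range (\<lambda>i. column i F)) = range ((*v) F)"
proof
  show "vec.span (range (\<lambda>i. column i F)) \<subseteq> range ((*v) F)"
  proof (rule vec.span_minimal)
    have "column i F = F *v axis i 1" for i
      by (simp add: vec_eq_iff column_def matrix_vector_mult_def axis_def if_distrib cong: if_cong)
    then show "range (\<lambda>i. column i F) \<subseteq> range ((*v) F)" by blast
    show "vec.subspace (range ((*v) F))"
      by (intro vec.subspace_image matrix_vector_mul_linear_gen vec.subspace_UNIV)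
  qed
  show "range ((*v) F) \<subseteq> vec.span (range (\<lambda>i. column i F))"
    by (auto simp: matrix_mult_sum intro!: vec.span_sum vec.span_scale intro: vec.span_base)
qed

lemma is_frame_iff_range: "is_frame L F \<longleftrightarrow> range L \<subseteq> range ((*v) F)"
  by (simp add: is_frame_def subframe_def span_columns_eq_range)

text \<open>If \<open>c\<close> are coefficients of \<open>L x\<close> in \<open>F\<close>, then
  \<open>adj U *v c\<close> are coefficients of \<open>A *v L x\<close> in the new family.
  \<open>A\<close> may be rectangular, as the tight case requires.\<close>

lemma is_frame_mult_unitary:
  assumes "is_frame L F" "unitary_matrix U"
  shows "is_frame ((*v) A \<circ> L) (A ** F ** U)"
proof -
  have "\<exists>y. A *v L x = (A ** F ** U) *v y" for x
  proof -
    obtain c where "L x = F *v c"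
      using assms(1) unfolding is_frame_iff_range by blast
    moreover have "(A ** F ** U) *v (adj U *v c) = (A ** F ** (U ** adj U)) *v c"
      by (simp add: matrix_vector_mul_assoc matrix_mul_assoc)
    ultimately have "A *v L x = (A ** F ** U) *v (adj U *v c)"
      using assms(2) by (simp add: unitary_matrix_def matrix_vector_mul_assoc)
    then show ?thesis by blast
  qed
  then show ?thesis by (auto simp: is_frame_iff_range)
qed

lemma is_frame_right_unitary:
  assumes "is_frame L F" "unitary_matrix U"
  shows "is_frame L (F ** U)"
  using is_frame_mult_unitary[OF assms, of "mat 1"] by (simp add: o_def)

text \<open>Each \<open>A *v column i F\<close> is a scalar multiple of the new column with the same
  index, so \<open>A\<close> maps the span of the kept columns into the span of the new ones, for
  the same \<open>S\<close>.\<close>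

lemma subframe_mult_diagonal:
  assumes "subframe L F S" "unitary_matrix D" "diagonal_matrix D"
  shows "subframe ((*v) A \<circ> L) (A ** F ** D) S"
proof -
  let ?V = "vec.span ((\<lambda>i. column i (A ** F ** D)) ` S)"
  have "A *v column i F \<in> ?V" if "i \<in> S" for i
  proof -
    have "column i (A ** F ** D) = D $ i $ i *s (A *v column i F)"
      by (simp only: column_mult_diagonal[OF assms(3)] column_matrix_mult[of _ A])
    then have "A *v column i F = cnj (D $ i $ i) *s column i (A ** F ** D)"
      using unitary_diagonal_entry[OF assms(2,3), of i] by (simp add: vector_smult_assoc)
    then show ?thesis
      using that by (auto intro!: vec.span_scale intro: vec.span_base)
  qed
  then have "vec.span ((*v) A ` (\<lambda>i. column i F) ` S) \<subseteq> ?V"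
    by (intro vec.span_minimal) auto
  moreover have "(*v) A ` vec.span ((\<lambda>i. column i F) ` S)
      = vec.span ((*v) A ` (\<lambda>i. column i F) ` S)"
    by (metis vec.linear_span_image matrix_vector_mul_linear_gen)
  ultimately show ?thesis
    using assms(1) unfolding subframe_def by fastforce
qed

text \<open>Exactness also asserts that smaller subfamilies fail to be frames, so both directions
  are needed. For the converse, a left inverse of \<open>A\<close> and \<open>adj D\<close> bring
  the product back to \<open>F\<close> and the operator back to \<open>L\<close>.\<close>

lemma subframe_mult_diagonal_iff:
  fixes L :: "complex^'a \<Rightarrow> complex^'b"
  assumes "invertible A" "unitary_matrix D" "diagonal_matrix D"
  shows "subframe ((*v) A \<circ> L) (A ** F ** D) S \<longleftrightarrow> subframe L F S"
proof
  obtain B where B: "B ** A = mat 1" using assms(1) by (auto simp: invertible_def)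
  assume "subframe ((*v) A \<circ> L) (A ** F ** D) S"
  then have "subframe ((*v) B \<circ> ((*v) A \<circ> L)) (B ** (A ** F ** D) ** adj D) S"
    by (rule subframe_mult_diagonal[OF _ unitary_matrix_adj[OF assms(2)]
          diagonal_matrix_adj[OF assms(3)]])
  moreover have "B ** (A ** F ** D) ** adj D = (B ** A) ** F ** (D ** adj D)"
    by (simp add: matrix_mul_assoc)
  then have "B ** (A ** F ** D) ** adj D = F"
    using B assms(2) by (simp add: unitary_matrix_def)
  moreover have "(*v) B \<circ> ((*v) A \<circ> L) = L"
    using B by (simp add: o_def matrix_vector_mul_assoc)
  ultimately show "subframe L F S" by (simp only:)
qed (rule subframe_mult_diagonal[OF _ assms(2,3)])

text \<open>Maximal robustness ranges over index sets of size equal to the rank, so the two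
  operators must have the same rank.\<close>

lemma dim_range_invertible:
  assumes "invertible A" "Vector_Spaces.linear (*s) (*s) L"
  shows "vec.dim (range ((*v) A \<circ> L)) = vec.dim (range L)"
proof -
  have "inj ((*v) A)"
    using assms(1) by (simp add: invertible_eq_bij bij_is_inj)
  then have "vec.dim ((*v) A ` range L) = vec.dim (range L)"
    by (intro vec.dim_image_eq matrix_vector_mul_linear_gen) (auto intro: inj_on_subset)
  then show ?thesis by (simp add: image_comp)
qed

lemma maximal_robust_mult_diagonal:
  assumes "Vector_Spaces.linear (*s) (*s) L" "maximal_robust L F"
    and "invertible A" "unitary_matrix D" "diagonal_matrix D"
  shows "maximal_robust ((*v) A \<circ> L) (A ** F ** D)"
  using assms(2)
  unfolding maximal_robust_def exact_subframe_def is_frame_def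
    subframe_mult_diagonal_iff[OF assms(3-5)] dim_range_invertible[OF assms(3,1)] .

lemma MRC_erasures_mult_diagonal:
  assumes "MRC_erasures r L F" "unitary_matrix D" "diagonal_matrix D"
  shows "MRC_erasures r ((*v) A \<circ> L) (A ** F ** D)"
  using assms by (simp add: MRC_erasures_def MRC_def is_frame_def subframe_mult_diagonal)

lemma matrix_mult_comp:
  assumes "Vector_Spaces.linear (*s) (*s) L"
  shows "matrix ((*v) A \<circ> L) = A ** matrix L"
  using assms by (simp add: matrix_compose_gen matrix_vector_mul_linear_gen)

text \<open>Once \<open>U\<close> cancels, what remains is the dual equation of \<open>F\<close>
  multiplied by \<open>A\<close>. It follows from the original equation for every \<open>A\<close>,
  and is equivalent to it for invertible \<open>A\<close>.\<close>

lemma mem_duals_mult_unitary: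
  assumes "Vector_Spaces.linear (*s) (*s) L" "unitary_matrix U"
  shows "G ** U \<in> duals ((*v) A \<circ> L) (A ** F ** U) \<longleftrightarrow> A ** (F ** adj G) = A ** matrix L"
  using assms by (simp add: duals_def matrix_mult_comp unitary_cancel matrix_mul_assoc)

lemma invertible_matrix_mult_left_cancel:
  assumes "invertible A"
  shows "A ** B = A ** C \<longleftrightarrow> B = C"
  using assms by (metis invertible_def matrix_mul_assoc matrix_mul_lid)

lemma tight_frame_right_unitary:
  assumes "tight_frame \<alpha> L F" "unitary_matrix U"
  shows "tight_frame \<alpha> L (F ** U)"
  using assms by (simp add: tight_frame_def is_frame_right_unitary unitary_cancel)

theorem theorem4p3:
  fixes K :: "complex^'n \<Rightarrow> complex^'n"
    and F :: "complex^'m^'n"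
  assumes K: "Vector_Spaces.linear (*s) (*s) K"
    and F: "is_frame K F"
  shows
    "(\<forall>(A :: complex^'n^'n) (U :: complex^'m^'m). unitary_matrix U \<longrightarrow>
        is_frame ((*v) A \<circ> K) (A ** F ** U) \<and>
        is_frame K (F ** U) \<and>
        (\<forall>G \<in> duals K F. G ** U \<in> duals ((*v) A \<circ> K) (A ** F ** U)))
     \<and>
     (\<forall>(A :: complex^'n^'n) (U :: complex^'m^'m) (G :: complex^'m^'n).
        invertible A \<and> unitary_matrix U \<longrightarrow>
        (G \<in> duals K F \<longleftrightarrow> G ** U \<in> duals ((*v) A \<circ> K) (A ** F ** U)))
     \<and>
     (\<forall>(\<alpha> :: real). tight_frame \<alpha> K F \<longrightarrow>
        (\<forall>(A :: complex^'n^'p) (U :: complex^'m^'m). unitary_matrix U \<longrightarrow>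
           is_frame ((*v) A \<circ> K) (A ** F ** U) \<and>
           tight_frame \<alpha> K (F ** U)))
     \<and>
     (equal_norm F \<longrightarrow>
        (\<forall>(U :: complex^'n^'n) (D :: complex^'m^'m).
           unitary_matrix U \<and> unitary_matrix D \<and> diagonal_matrix D \<longrightarrow>
           equal_norm (U ** F ** D)))
     \<and>
     (maximal_robust K F \<longrightarrow>
        (\<forall>(A :: complex^'n^'n) (D :: complex^'m^'m).
           invertible A \<and> unitary_matrix D \<and> diagonal_matrix D \<longrightarrow>
           maximal_robust ((*v) A \<circ> K) (A ** F ** D)))
     \<and>
     (\<forall>(r :: nat). MRC_erasures r K F \<longrightarrow>
        (\<forall>(A :: complex^'n^'n) (D :: complex^'m^'m).
           unitary_matrix D \<and> diagonal_matrix D \<longrightarrow>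
           MRC_erasures r ((*v) A \<circ> K) (A ** F ** D)))"
proof (intro conjI allI impI ballI; (elim conjE)?)
  fix A :: "complex^'n^'n" and U :: "complex^'m^'m" and G
  assume U: "unitary_matrix U"
  show "is_frame ((*v) A \<circ> K) (A ** F ** U)" by (rule is_frame_mult_unitary[OF F U])
  show "is_frame K (F ** U)" by (rule is_frame_right_unitary[OF F U])
  show "G ** U \<in> duals ((*v) A \<circ> K) (A ** F ** U)" if "G \<in> duals K F"
    \<comment> \<open>Membership of \<open>G ** U\<close> is rewritten first; only then is
      \<open>duals\<close> unfolded for \<open>G\<close>.\<close>
    using that by (simp add: mem_duals_mult_unitary[OF K U]) (simp add: duals_def)
  show "G \<in> duals K F \<longleftrightarrow> G ** U \<in> duals ((*v) A \<circ> K) (A ** F ** U)" if "invertible A"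
    using that by (simp add: mem_duals_mult_unitary[OF K U] invertible_matrix_mult_left_cancel)
      (simp add: duals_def)
next
  fix \<alpha> and A :: "complex^'n^'p" and U :: "complex^'m^'m"
  assume t: "tight_frame \<alpha> K F" and U: "unitary_matrix U"
  show "is_frame ((*v) A \<circ> K) (A ** F ** U)" by (rule is_frame_mult_unitary[OF F U])
  show "tight_frame \<alpha> K (F ** U)" by (rule tight_frame_right_unitary[OF t U])
next
  fix U :: "complex^'n^'n" and D :: "complex^'m^'m"
  assume "equal_norm F" "unitary_matrix U" "unitary_matrix D" "diagonal_matrix D"
  then show "equal_norm (U ** F ** D)"
    by (simp add: equal_norm_def norm_column_unitary_diagonal)
qed (use K in \<open>simp_all add: maximal_robust_mult_diagonal MRC_erasures_mult_diagonal\<close>)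

end
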